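(* Let $G$ be a finite simple undirected graph on $n\ge 3$ vertices, and let $\lambda_1(G)\ge \lambda_2(G)\ge\cdots\ge\lambda_n(G)$ be the eigenvalues of its adjacency matrix. Then \[ \lambda_3(G)\le \frac{n}{3}-1. \] *)

theory Defs
  imports "Jordan_Normal_Form.Char_Poly" "HOL-Library.Multiset"
begin

definition simple_graph :: "nat \<Rightarrow> (nat \<Rightarrow> nat \<Rightarrow> bool) \<Rightarrow> bool" where
  "simple_graph n E \<longleftrightarrow>
     (\<forall>i<n. \<forall>j<n. E i j \<longleftrightarrow> E j i) \<and> (\<forall>i<n. \<not> E i i)"

definition adj_matrix :: "nat \<Rightarrow> (nat \<Rightarrow> nat \<Rightarrow> bool) \<Rightarrow> real mat" where
  "adj_matrix n E = mat n n (\<lambda>(i, j). if E i j then 1 else 0)"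

text \<open>Eigenvalues of a real matrix, listed with algebraic multiplicity in
  non-increasing order: the roots of the characteristic polynomial.
  (For symmetric real matrices all n eigenvalues are real.)\<close>
definition eigenvalues_desc :: "real mat \<Rightarrow> real list" where
  "eigenvalues_desc A = rev (sorted_list_of_multiset (proots (char_poly A)))"

definition lambda_k :: "nat \<Rightarrow> real mat \<Rightarrow> real" where
  "lambda_k k A = eigenvalues_desc A ! (k - 1)"

end

theory Submission
  imports Defs "Jordan_Normal_Form.Schur_Decomposition"
    "HOL-Analysis.Topology_Euclidean_Space" "HOL-Analysis.Convex"
begin

text \<open>
  Let \<open>B = A + I\<close>, a symmetric matrix with entries in \<open>[0, 1]\<close>, and let \<open>U\<close> be a plane of vectors
  orthogonal to the all-ones vector inside the span of the first three eigenvectors. On \<open>U\<close> the form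
  of \<open>B\<close> is at least \<open>\<lambda>\<^sub>3 + 1\<close> times the squared norm. A basis \<open>x, y\<close> of \<open>U\<close> gives complex numbers
  \<open>z i = x i + \<i> y i\<close>, and a suitable change of basis of \<open>U\<close> achieves \<open>\<Sum> |z i| (sgn (z i))\<^sup>2 = 0\<close>.
  The pointwise bound \<open>|cos t| \<le> 2/3 + 7/18 cos 2t - 1/18 cos 4t\<close>, summed over the angles between
  \<open>z i\<close> and \<open>z j\<close> with weights \<open>|z i| |z j|\<close>, then loses its second term by this normalisation, while
  the third has a favourable sign, so \<open>\<Sum> |Re (z i * cnj (z j))| \<le> 2/3 (\<Sum> |z i|)\<^sup>2\<close>. As
  \<open>\<Sum> z i = 0\<close>, it follows that \<open>x\<^sup>T B x + y\<^sup>T B y \<le> 1/3 (\<Sum> |z i|)\<^sup>2 \<le> n/3 (|x|\<^sup>2 + |y|\<^sup>2)\<close>.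
\<close>

section \<open>Balanced planar configurations\<close>

text \<open>With \<open>x = cos t\<close> the right-hand side is \<open>2/3 + 7/18 cos 2t - 1/18 cos 4t\<close>, the polynomial that
  touches \<open>|cos t|\<close> at multiples of 60 degrees.\<close>

lemma abs_le_cos_multiples:
  fixes x :: real
  assumes "\<bar>x\<bar> \<le> 1"
  shows "\<bar>x\<bar> \<le> 2/3 + 7/18 * (2 * x\<^sup>2 - 1) - 1/18 * (2 * (2 * x\<^sup>2 - 1)\<^sup>2 - 1)"
proof -
  define y where "y = \<bar>x\<bar>"
  have y: "0 \<le> y" "y \<le> 1" "x\<^sup>2 = y\<^sup>2"
    using assms by (auto simp: y_def)
  \<comment> \<open>The product is 18 times the difference of the two sides: a simple root at
    \<open>y = 1\<close> (0 degrees), a double root at \<open>y = 1/2\<close> (60 degrees), and the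
    rest is positive on the unit interval.\<close>
  have "0 \<le> 2 * ((1 - y) * (2 * y - 1)\<^sup>2 * (y + 2))"
    using y by simp
  also have "\<dots> = 12 + 7 * (2 * y\<^sup>2 - 1) - (2 * (2 * y\<^sup>2 - 1)\<^sup>2 - 1) - 18 * y"
    by (simp add: algebra_simps power2_eq_square)
  finally have "0 \<le> 12 + 7 * (2 * x\<^sup>2 - 1) - (2 * (2 * x\<^sup>2 - 1)\<^sup>2 - 1) - 18 * \<bar>x\<bar>"
    by (simp only: y(3) y_def)
  moreover have "u \<le> 2/3 + 7/18 * a - 1/18 * b" if "0 \<le> 12 + 7 * a - b - 18 * u" for u a b :: real
    using that by linarith
  ultimately show ?thesis by blast
qed

lemma Re_power2_unit:
  fixes t :: complex
  assumes "norm t = 1"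
  shows "Re (t\<^sup>2) = 2 * (Re t)\<^sup>2 - 1"
proof -
  have "(Re t)\<^sup>2 + (Im t)\<^sup>2 = 1"
    using assms by (simp add: cmod_def)
  thus ?thesis
    by (simp add: power2_eq_square)
qed

text \<open>With \<open>t = sgn z * cnj (sgn w)\<close> on the unit circle, \<open>Re t\<close>,
  \<open>Re (t\<^sup>2)\<close> and \<open>Re (t^4)\<close> are the cosines of the angle, its double
  and its quadruple. Each cosine is written as \<open>f z * cnj (f w)\<close> so that its double sum
  becomes a squared modulus.\<close>

lemma abs_Re_mult_cnj_le:
  fixes z w :: complex
  shows "\<bar>Re (z * cnj w)\<bar> \<le> 2/3 * (norm z * norm w)
    + 7/18 * Re ((norm z * (sgn z)\<^sup>2) * cnj (norm w * (sgn w)\<^sup>2))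
    - 1/18 * Re ((norm z * (sgn z)^4) * cnj (norm w * (sgn w)^4))"
proof (cases "z = 0 \<or> w = 0")
  case False
  define t where "t = sgn z * cnj (sgn w)"
  define r where "r = norm z * norm w"
  have t: "norm t = 1" and r: "r \<ge> 0"
    using False by (auto simp: t_def r_def norm_mult norm_sgn)
  have zw: "z * cnj w = of_real r * t"
    using False by (simp add: t_def r_def sgn_eq)
  have t2: "(norm z * (sgn z)\<^sup>2) * cnj (norm w * (sgn w)\<^sup>2) = of_real r * t\<^sup>2"
    by (simp add: t_def r_def power_mult_distrib)
  have t4: "(norm z * (sgn z)^4) * cnj (norm w * (sgn w)^4) = of_real r * (t\<^sup>2)\<^sup>2"
    by (simp add: t_def r_def power_mult_distrib)
  have "\<bar>Re t\<bar> \<le> 1"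
    using abs_Re_le_cmod[of t] t by simp
  from abs_le_cos_multiples[OF this]
  have "\<bar>Re t\<bar> \<le> 2/3 + 7/18 * Re (t\<^sup>2) - 1/18 * Re ((t\<^sup>2)\<^sup>2)"
    by (simp only: Re_power2_unit[OF t] Re_power2_unit[of "t\<^sup>2"] norm_power t power_one)
  from mult_left_mono[OF this r] show ?thesis
    unfolding zw t2 t4 unfolding r_def[symmetric] using r
    by (simp add: abs_mult algebra_simps del: Re_power2)
qed auto

lemma sum_Re_mult_cnj:
  fixes f :: "'i \<Rightarrow> complex"
  shows "(\<Sum>i\<in>I. \<Sum>j\<in>I. Re (f i * cnj (f j))) = (norm (\<Sum>i\<in>I. f i))\<^sup>2"
proof -
  have "(\<Sum>i\<in>I. \<Sum>j\<in>I. f i * cnj (f j)) = (\<Sum>i\<in>I. f i) * cnj (\<Sum>i\<in>I. f i)"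
    by (simp only: cnj_sum sum_product)
  also have "\<dots> = of_real ((norm (\<Sum>i\<in>I. f i))\<^sup>2)"
    by (rule complex_norm_square[symmetric])
  finally have "(\<Sum>i\<in>I. \<Sum>j\<in>I. f i * cnj (f j)) = of_real ((norm (\<Sum>i\<in>I. f i))\<^sup>2)" .
  from arg_cong[OF this, of Re] show ?thesis
    by (simp only: Re_sum Re_complex_of_real)
qed

lemma sum_abs_Re_balanced:
  fixes z :: "'i \<Rightarrow> complex"
  assumes bal: "(\<Sum>i\<in>I. norm (z i) * (sgn (z i))\<^sup>2) = 0"
  shows "(\<Sum>i\<in>I. \<Sum>j\<in>I. \<bar>Re (z i * cnj (z j))\<bar>) \<le> 2/3 * (\<Sum>i\<in>I. norm (z i))\<^sup>2"
proof -
  define f where "f k i = complex_of_real (norm (z i)) * (sgn (z i)) ^ k" for k :: nat and i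
  have "(\<Sum>i\<in>I. \<Sum>j\<in>I. \<bar>Re (z i * cnj (z j))\<bar>) \<le>
     (\<Sum>i\<in>I. \<Sum>j\<in>I. 2/3 * (norm (z i) * norm (z j)) + 7/18 * Re (f 2 i * cnj (f 2 j))
        - 1/18 * Re (f 4 i * cnj (f 4 j)))"
    unfolding f_def by (intro sum_mono abs_Re_mult_cnj_le)
  also have "\<dots> = 2/3 * (\<Sum>i\<in>I. \<Sum>j\<in>I. norm (z i) * norm (z j))
      + 7/18 * (\<Sum>i\<in>I. \<Sum>j\<in>I. Re (f 2 i * cnj (f 2 j)))
      - 1/18 * (\<Sum>i\<in>I. \<Sum>j\<in>I. Re (f 4 i * cnj (f 4 j)))"
    by (simp only: sum.distrib sum_subtractf sum_distrib_left)
  also have "\<dots> = 2/3 * (\<Sum>i\<in>I. norm (z i))\<^sup>2 + 7/18 * (norm (\<Sum>i\<in>I. f 2 i))\<^sup>2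
      - 1/18 * (norm (\<Sum>i\<in>I. f 4 i))\<^sup>2"
    by (simp only: sum_Re_mult_cnj power2_eq_square sum_product)
  also have "\<dots> \<le> 2/3 * (\<Sum>i\<in>I. norm (z i))\<^sup>2"
    using bal by (simp add: f_def)
  finally show ?thesis .
qed

section \<open>Balancing by minimising a sum of norms\<close>

text \<open>First-order expansion with quadratic error. After scaling to a unit vector
  \<open>s\<close>, the norm \<open>q\<close> of \<open>s + c * cnj s\<close> satisfies
  \<open>q \<le> (q\<^sup>2 + 1) / 2\<close>, with equality at \<open>c = 0\<close>, and
  \<open>q\<^sup>2\<close> is explicit.\<close>

lemma norm_add_cnj_le:
  fixes z c :: complex
  shows "norm (z + c * cnj z) \<le> norm z * (1 + (norm c)\<^sup>2 / 2) + Re (c * cnj (norm z * (sgn z)\<^sup>2))"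
proof (cases "z = 0")
  case False
  define r where "r = norm z"
  have r: "r > 0" using False by (simp add: r_def)
  have "norm (z + c * cnj z) = r * norm (sgn z + c * cnj (sgn z))"
  proof -
    have "z + c * cnj z = of_real r * (sgn z + c * cnj (sgn z))"
      using False by (simp add: r_def sgn_eq field_simps)
    thus ?thesis using r by (simp add: norm_mult)
  qed
  define s where "s = sgn z"
  define q where "q = norm (s + c * cnj s)"
  have s: "(Re s)\<^sup>2 + (Im s)\<^sup>2 = 1" 
    using False norm_sgn[of z] by (simp add: s_def cmod_def)
  have "q\<^sup>2 = 1 + (norm c)\<^sup>2 + 2 * Re (c * cnj (s\<^sup>2))"
  proof -
    have "q\<^sup>2 = ((Re s)\<^sup>2 + (Im s)\<^sup>2) * (1 + (Re c)\<^sup>2 + (Im c)\<^sup>2) + 2 * Re (c * cnj (s\<^sup>2))"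
      unfolding q_def cmod_power2 by (simp add: power2_eq_square algebra_simps)
    thus ?thesis using s by (simp add: cmod_power2)
  qed
  moreover have "q \<le> (q\<^sup>2 + 1) / 2"
    using zero_le_power2[of "q - 1"] by (simp add: power2_eq_square algebra_simps)
  ultimately have "q \<le> 1 + (norm c)\<^sup>2 / 2 + Re (c * cnj (s\<^sup>2))" by simp
  from mult_left_mono[OF this, of r] r
  have "r * q \<le> r * (1 + (norm c)\<^sup>2 / 2) + r * Re (c * cnj (s\<^sup>2))"
    by (simp add: algebra_simps)
  moreover have "r * Re (c * cnj (s\<^sup>2)) = Re (c * cnj (of_real r * s\<^sup>2))"
    by (simp add: algebra_simps)
  ultimately show ?thesis
    using \<open>norm (z + c * cnj z) = _\<close> unfolding q_def s_def r_def by simp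
qed auto

text \<open>The maps \<open>z \<mapsto> z + b * cnj z\<close> with \<open>norm b < 1\<close> represent \<open>SL(2, \<real>)\<close> up to rotations and scaling.
  A maximiser of \<open>G\<close>, i.e. a minimiser of \<open>\<Sum> norm (T (z i))\<close> over such \<open>T\<close> of determinant 1, is
  balanced, because perturbing it by \<open>c\<close> changes the sum of norms to first order by
  \<open>Re (c * cnj (\<Sum> norm (w i) * (sgn (w i))\<^sup>2))\<close>.\<close>

lemma exists_balancing:
  fixes z :: "'i \<Rightarrow> complex"
  assumes fin: "finite I"
    and nondeg: "\<And>b. \<exists>i\<in>I. z i + b * cnj (z i) \<noteq> 0"
  obtains b where "(\<Sum>i\<in>I. norm (z i + b * cnj (z i)) * (sgn (z i + b * cnj (z i)))\<^sup>2) = 0"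
proof -
  define N where "N b = (\<Sum>i\<in>I. norm (z i + b * cnj (z i)))" for b
  have Npos: "N b > 0" for b
  proof -
    obtain i where i: "i \<in> I" "z i + b * cnj (z i) \<noteq> 0" using nondeg by blast
    show ?thesis unfolding N_def
      by (rule sum_pos2[OF fin i(1)]) (use i in auto)
  qed
  \<comment> \<open>\<open>1 - (norm b)\<^sup>2\<close> is the determinant of the real-linear map
    \<open>z \<mapsto> z + b * cnj z\<close>; dividing by \<open>(N b)\<^sup>2\<close> makes the
    quotient invariant under scaling of the map.\<close>
  define G where "G b = (1 - (norm b)\<^sup>2) / (N b)\<^sup>2" for b
  \<comment> \<open>Nondegeneracy keeps \<open>N\<close> positive on the closed disc, boundary
    included. As \<open>G\<close> vanishes on the unit circle and is positive at 0, the maximiser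
    lies in the open disc.\<close>
  have "continuous_on (cball 0 1) G"
    unfolding G_def N_def
    using Npos unfolding N_def by (intro continuous_intros) (auto simp: less_imp_neq[symmetric] dest: less_imp_neq)
  then obtain b where b: "norm b \<le> 1" and max: "\<And>y. norm y \<le> 1 \<Longrightarrow> G y \<le> G b"
    using continuous_attains_sup[of "cball (0::complex) 1" G] by auto
  have "0 < G 0" using Npos[of 0] by (simp add: G_def)
  hence "G b > 0" using max[of 0] by simp
  hence b1: "1 - (norm b)\<^sup>2 > 0" using Npos[of b] by (simp add: G_def zero_less_divide_iff)
  define w where "w i = z i + b * cnj (z i)" for i
  define R where "R = (\<Sum>i\<in>I. norm (w i))"
  define S where "S = (\<Sum>i\<in>I. norm (w i) * (sgn (w i))\<^sup>2)"
  have R: "R > 0" "R = N b" using Npos[of b] by (auto simp: R_def N_def w_def)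
  have key: "(1 - (norm c)\<^sup>2) * R\<^sup>2 \<le> (\<Sum>i\<in>I. norm (w i + c * cnj (w i)))\<^sup>2" if c: "norm c < 1" for c
  proof -
    define k where "k = 1 + c * cnj b"
    have "norm b \<le> 1" by fact
    hence "norm (c * cnj b) < 1"
      using c mult_left_mono[of "norm b" 1 "norm c"] by (simp add: norm_mult)
    hence "c * cnj b \<noteq> - 1" by auto
    hence k: "k \<noteq> 0" by (simp add: k_def add_eq_0_iff)
    \<comment> \<open>Composing the maps for \<open>b\<close> and \<open>c\<close> gives the map for
      \<open>b'\<close> followed by multiplication by \<open>k\<close>. The identity below for
      \<open>(norm k)\<^sup>2 - (norm (b + c))\<^sup>2\<close> is multiplicativity of
      determinants.\<close>
    define b' where "b' = (b + c) / k"
    have eq: "w i + c * cnj (w i) = k * (z i + b' * cnj (z i))" for i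
      using k unfolding b'_def w_def by (simp add: field_simps) (simp add: k_def algebra_simps)
    have nk: "(norm k)\<^sup>2 > 0" using k by simp
    have "(norm k)\<^sup>2 - (norm (b + c))\<^sup>2 = (1 - (norm b)\<^sup>2) * (1 - (norm c)\<^sup>2)"
      unfolding k_def cmod_power2 by (simp add: power2_eq_square algebra_simps)
    hence b'eq: "1 - (norm b')\<^sup>2 = (1 - (norm b)\<^sup>2) * (1 - (norm c)\<^sup>2) / (norm k)\<^sup>2"
      using nk by (simp add: b'_def norm_divide power_divide field_simps)
    have c2: "1 - (norm c)\<^sup>2 > 0" using c by (simp add: power_less_one_iff)
    have "1 - (norm b')\<^sup>2 \<ge> 0" unfolding b'eq using b1 c2 by simp
    hence "norm b' \<le> 1" by (simp add: power_le_one_iff)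
    from max[OF this] have "(1 - (norm b)\<^sup>2) * (1 - (norm c)\<^sup>2) / (norm k)\<^sup>2 / (N b')\<^sup>2 \<le> (1 - (norm b)\<^sup>2) / R\<^sup>2"
      by (simp add: G_def b'eq R(2))
    hence "(1 - (norm b)\<^sup>2) * ((1 - (norm c)\<^sup>2) * R\<^sup>2) \<le> (1 - (norm b)\<^sup>2) * ((norm k)\<^sup>2 * (N b')\<^sup>2)"
      using nk Npos[of b'] R(1) by (simp add: divide_simps mult_ac)
    hence "(1 - (norm c)\<^sup>2) * R\<^sup>2 \<le> (norm k * N b')\<^sup>2"
      using b1 by (simp add: power_mult_distrib)
    also have "norm k * N b' = (\<Sum>i\<in>I. norm (w i + c * cnj (w i)))"
      unfolding eq N_def by (simp add: norm_mult sum_distrib_left)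
    finally show ?thesis .
  qed
  have "S = 0"
  proof (rule ccontr)
    assume S: "S \<noteq> 0"
    have le: "t * norm S \<le> 3/2 * t\<^sup>2 * R" if t: "0 < t" "t < 1" for t :: real
    proof -
      \<comment> \<open>Steepest descent: \<open>c\<close> points against \<open>S\<close>, so the
        linear term becomes \<open>- t * norm S\<close>.\<close>
      define c where "c = - of_real t * sgn S"
      have nc: "norm c = t" using S t by (simp add: c_def norm_mult norm_sgn)
      have "(\<Sum>i\<in>I. norm (w i + c * cnj (w i))) \<le>
          (\<Sum>i\<in>I. norm (w i) * (1 + t\<^sup>2 / 2) + Re (c * cnj (norm (w i) * (sgn (w i))\<^sup>2)))"
        unfolding nc[symmetric] by (intro sum_mono norm_add_cnj_le)
      also have "\<dots> = R * (1 + t\<^sup>2 / 2) + Re (c * cnj S)"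
        unfolding S_def R_def cnj_sum sum_distrib_left sum_distrib_right Re_sum
        by (simp only: sum.distrib)
      also have "c * cnj S = - of_real (t * norm S)"
      proof -
        have "c * cnj S = - of_real t * (S * cnj S) / of_real (norm S)"
          by (simp add: c_def sgn_eq)
        also have "S * cnj S = of_real (norm S) * of_real (norm S)"
          by (simp only: complex_norm_square[symmetric] power2_eq_square of_real_mult)
        finally show ?thesis using S by simp
      qed
      finally have ub: "(\<Sum>i\<in>I. norm (w i + c * cnj (w i))) \<le> R * (1 + t\<^sup>2 / 2) - t * norm S"
        by simp
      have t2: "t\<^sup>2 < 1" using t by (simp add: power_less_one_iff)
      \<comment> \<open>Weakening the factor \<open>1 - t\<^sup>2\<close> in \<open>key\<close> to
        its square avoids a square root and costs only a term of order
        \<open>t\<^sup>2\<close>.\<close>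
      have "((1 - t\<^sup>2) * R)\<^sup>2 \<le> (1 - t\<^sup>2) * R\<^sup>2"
        using mult_right_mono[of "(1 - t\<^sup>2) * (1 - t\<^sup>2)" "1 - t\<^sup>2" "R\<^sup>2"] t2 
          mult_left_mono[of "1 - t\<^sup>2" 1 "1 - t\<^sup>2"]
        by (simp add: power2_eq_square mult_ac)
      also have "\<dots> \<le> (\<Sum>i\<in>I. norm (w i + c * cnj (w i)))\<^sup>2"
        using key[of c] t nc by simp
      finally have "(1 - t\<^sup>2) * R \<le> (\<Sum>i\<in>I. norm (w i + c * cnj (w i)))"
        by (rule power2_le_imp_le) (simp add: sum_nonneg)
      with ub have "(1 - t\<^sup>2) * R \<le> R * (1 + t\<^sup>2 / 2) - t * norm S" by linarith
      thus ?thesis by (simp add: algebra_simps)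
    qed
    \<comment> \<open>A linear gain cannot stay below a quadratic bound: this \<open>t\<close> makes
      \<open>3/2 * t * R\<close> at most half of \<open>norm S\<close>.\<close>
    define t where "t = min (1/2) (norm S / (3 * R))"
    have t: "0 < t" "t < 1" using S R by (auto simp: t_def)
    from le[OF this] t have "norm S \<le> 3/2 * t * R"
      by (simp add: power2_eq_square mult.assoc)
    also have "3/2 * t * R \<le> 3/2 * (norm S / (3 * R)) * R"
      using R by (intro mult_right_mono mult_left_mono) (auto simp: t_def)
    also have "\<dots> = norm S / 2" using R by (simp add: field_simps)
    finally show False using S by simp
  qed
  thus thesis
    by (intro that[of b]) (simp add: S_def w_def)
qed

section \<open>Quadratic forms with weights between 0 and 1\<close>

text \<open>The worst weights select the positive parts \<open>(|c| + c) / 2\<close> of the entries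
  \<open>c = Re (z i * cnj (z j))\<close>, and the linear parts cancel because \<open>z\<close> sums to zero.\<close>

lemma weighted_form_le_balanced:
  fixes z :: "'i \<Rightarrow> complex" and B :: "'i \<Rightarrow> 'i \<Rightarrow> real"
  assumes B: "\<And>i j. i \<in> I \<Longrightarrow> j \<in> I \<Longrightarrow> 0 \<le> B i j \<and> B i j \<le> 1"
    and zero: "(\<Sum>i\<in>I. z i) = 0"
    and bal: "(\<Sum>i\<in>I. norm (z i) * (sgn (z i))\<^sup>2) = 0"
  shows "(\<Sum>i\<in>I. \<Sum>j\<in>I. B i j * Re (z i * cnj (z j))) \<le> card I / 3 * (\<Sum>i\<in>I. (norm (z i))\<^sup>2)"
proof -
  have "(\<Sum>i\<in>I. \<Sum>j\<in>I. B i j * Re (z i * cnj (z j))) \<le>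
      (\<Sum>i\<in>I. \<Sum>j\<in>I. \<bar>Re (z i * cnj (z j))\<bar> / 2 + Re (z i * cnj (z j)) / 2)"
  proof (intro sum_mono)
    fix i j assume "i \<in> I" "j \<in> I"
    hence b: "0 \<le> B i j" "B i j \<le> 1" using B by auto
    have "B i j * x \<le> \<bar>x\<bar> / 2 + x / 2" for x
    proof (cases "x \<ge> 0")
      case True thus ?thesis using mult_right_mono[OF b(2) True] by simp
    next
      case False thus ?thesis using mult_nonneg_nonpos[OF b(1), of x] by simp
    qed
    thus "B i j * Re (z i * cnj (z j)) \<le> \<bar>Re (z i * cnj (z j))\<bar> / 2 + Re (z i * cnj (z j)) / 2" .
  qed
  also have "\<dots> = (\<Sum>i\<in>I. \<Sum>j\<in>I. \<bar>Re (z i * cnj (z j))\<bar>) / 2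
      + (\<Sum>i\<in>I. \<Sum>j\<in>I. Re (z i * cnj (z j))) / 2"
    by (simp only: sum.distrib sum_divide_distrib)
  also have "\<dots> \<le> (2/3 * (\<Sum>i\<in>I. norm (z i))\<^sup>2) / 2 + 0"
    unfolding sum_Re_mult_cnj zero using sum_abs_Re_balanced[OF bal] by simp
  also have "\<dots> \<le> card I / 3 * (\<Sum>i\<in>I. (norm (z i))\<^sup>2)"
    using sum_squared_le_sum_of_squares[of "\<lambda>i. norm (z i)" I]
    by (simp add: mult.commute)
  finally show ?thesis .
qed

text \<open>The real and imaginary parts of the balanced configuration are two vectors of the plane.
  The bound holds for the sum of their forms, hence for at least one of them.\<close>

lemma exists_small_form_in_plane:
  fixes x y :: "'i \<Rightarrow> real" and B :: "'i \<Rightarrow> 'i \<Rightarrow> real"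
  assumes fin: "finite I"
    and B: "\<And>i j. i \<in> I \<Longrightarrow> j \<in> I \<Longrightarrow> 0 \<le> B i j \<and> B i j \<le> 1"
    and x0: "(\<Sum>i\<in>I. x i) = 0" and y0: "(\<Sum>i\<in>I. y i) = 0"
    and indep: "\<And>s t. (\<And>i. i \<in> I \<Longrightarrow> s * x i + t * y i = 0) \<Longrightarrow> s = 0 \<and> t = 0"
  obtains s t where "s \<noteq> 0 \<or> t \<noteq> 0"
    and "(\<Sum>i\<in>I. \<Sum>j\<in>I. B i j * ((s * x i + t * y i) * (s * x j + t * y j)))
           \<le> card I / 3 * (\<Sum>i\<in>I. (s * x i + t * y i)\<^sup>2)"
proof -
  define z where "z i = Complex (x i) (y i)" for i
  \<comment> \<open>A degenerate \<open>b\<close> would give two linear relations between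
    \<open>x\<close> and \<open>y\<close>; independence would then force both
    \<open>Re b = -1\<close> and \<open>Re b = 1\<close>.\<close>
  have nondeg: "\<exists>i\<in>I. z i + b * cnj (z i) \<noteq> 0" for b
  proof (rule ccontr)
    assume "\<not> ?thesis"
    hence eq: "z i + b * cnj (z i) = 0" if "i \<in> I" for i using that by blast
    have "1 + Re b = 0 \<and> Im b = 0"
      by (rule indep) (use arg_cong[OF eq, of _ Re] in \<open>simp add: z_def algebra_simps\<close>)
    moreover have "Im b = 0 \<and> 1 - Re b = 0"
      by (rule indep) (use arg_cong[OF eq, of _ Im] in \<open>simp add: z_def algebra_simps\<close>)
    ultimately show False by simp
  qed
  obtain b where bal: "(\<Sum>i\<in>I. norm (z i + b * cnj (z i)) * (sgn (z i + b * cnj (z i)))\<^sup>2) = 0"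
    using exists_balancing[OF fin nondeg] by blast
  define F where "F s t = (\<Sum>i\<in>I. \<Sum>j\<in>I. B i j * ((s * x i + t * y i) * (s * x j + t * y j)))
      - card I / 3 * (\<Sum>i\<in>I. (s * x i + t * y i)\<^sup>2)" for s t
  define w where "w i = z i + b * cnj (z i)" for i
  have Re_w: "Re (w i) = (1 + Re b) * x i + Im b * y i" 
    and Im_w: "Im (w i) = Im b * x i + (1 - Re b) * y i" for i
    by (simp_all add: w_def z_def algebra_simps)
  have "(\<Sum>i\<in>I. z i) = 0"
    using x0 y0 by (simp add: complex_eq_iff z_def)
  hence w0: "(\<Sum>i\<in>I. w i) = 0"
    unfolding w_def by (simp only: sum.distrib sum_distrib_left[symmetric] cnj_sum[symmetric]) simp
  have "(\<Sum>i\<in>I. \<Sum>j\<in>I. B i j * Re (w i * cnj (w j))) \<le> card I / 3 * (\<Sum>i\<in>I. (norm (w i))\<^sup>2)"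
    by (rule weighted_form_le_balanced[OF B w0]) (use bal in \<open>auto simp: w_def\<close>)
  also have "(\<Sum>i\<in>I. \<Sum>j\<in>I. B i j * Re (w i * cnj (w j))) =
      (\<Sum>i\<in>I. \<Sum>j\<in>I. B i j * (Re (w i) * Re (w j))) + (\<Sum>i\<in>I. \<Sum>j\<in>I. B i j * (Im (w i) * Im (w j)))"
  proof -
    have "Re (w i * cnj (w j)) = Re (w i) * Re (w j) + Im (w i) * Im (w j)" for i j by simp
    thus ?thesis by (simp only: distrib_left sum.distrib)
  qed
  also have "(\<Sum>i\<in>I. (norm (w i))\<^sup>2) = (\<Sum>i\<in>I. (Re (w i))\<^sup>2) + (\<Sum>i\<in>I. (Im (w i))\<^sup>2)"
    by (simp add: cmod_power2 sum.distrib)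
  finally have le: "F (1 + Re b) (Im b) + F (Im b) (1 - Re b) \<le> 0"
    unfolding F_def Re_w Im_w by (simp add: distrib_left)
  have F00: "F 0 0 = 0" by (simp add: F_def)
  \<comment> \<open>The vector found must be nonzero. If the first coefficient pair vanishes, then
    \<open>b = -1\<close> and the second pair is \<open>(0, 2)\<close>; if instead the first pair
    has positive \<open>F\<close>, the second has negative \<open>F\<close> and so cannot be
    zero.\<close>
  have "\<exists>s t. (s \<noteq> 0 \<or> t \<noteq> 0) \<and> F s t \<le> 0"
  proof (cases "F (1 + Re b) (Im b) \<le> 0 \<and> (1 + Re b \<noteq> 0 \<or> Im b \<noteq> 0)")
    case False
    have "F (Im b) (1 - Re b) \<le> 0 \<and> (Im b \<noteq> 0 \<or> 1 - Re b \<noteq> 0)"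
    proof (cases "1 + Re b = 0 \<and> Im b = 0")
      case True
      thus ?thesis using le F00 by auto
    next
      case nz: False
      hence "F (1 + Re b) (Im b) > 0" using False by auto
      hence "F (Im b) (1 - Re b) < 0" using le by linarith
      moreover from this have "Im b \<noteq> 0 \<or> 1 - Re b \<noteq> 0" using F00 by fastforce
      ultimately show ?thesis by simp
    qed
    thus ?thesis by blast
  qed blast
  then obtain s t where "s \<noteq> 0 \<or> t \<noteq> 0" "F s t \<le> 0" by blast
  thus thesis
    by (intro that[of s t]) (simp_all add: F_def)
qed

section \<open>Orthogonal eigenvectors of real symmetric matrices\<close>

text \<open>Vectors are plain functions of which only the entries below \<open>n\<close> count, so a
  family is extended by a function update.\<close>

definition in_span :: "nat \<Rightarrow> nat \<Rightarrow> (nat \<Rightarrow> nat \<Rightarrow> real) \<Rightarrow> (nat \<Rightarrow> real) \<Rightarrow> bool" where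
  "in_span n m q x \<longleftrightarrow> (\<exists>c. \<forall>i<n. x i = (\<Sum>j<m. c j * q j i))"

lemma in_spanI: "(\<And>i. i < n \<Longrightarrow> x i = (\<Sum>j<m. c j * q j i)) \<Longrightarrow> in_span n m q x"
  unfolding in_span_def by blast

lemma in_span_Suc:
  "in_span n (Suc m) q x \<longleftrightarrow> (\<exists>t. in_span n m q (\<lambda>i. x i - t * q m i))"
proof
  assume "in_span n (Suc m) q x"
  then obtain c where "\<And>i. i < n \<Longrightarrow> x i = (\<Sum>j<Suc m. c j * q j i)"
    unfolding in_span_def by blast
  thus "\<exists>t. in_span n m q (\<lambda>i. x i - t * q m i)"
    by (intro exI[of _ "c m"] in_spanI[where c = c]) simp
next
  assume "\<exists>t. in_span n m q (\<lambda>i. x i - t * q m i)"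
  then obtain t c where c: "\<And>i. i < n \<Longrightarrow> x i - t * q m i = (\<Sum>j<m. c j * q j i)"
    unfolding in_span_def by blast
  show "in_span n (Suc m) q x"
  proof (rule in_spanI[where c = "c(m := t)"])
    fix i assume "i < n"
    have "(\<Sum>j<m. (c(m := t)) j * q j i) = (\<Sum>j<m. c j * q j i)"
      by (intro sum.cong) auto
    thus "x i = (\<Sum>j<Suc m. (c(m := t)) j * q j i)"
      using c[OF \<open>i < n\<close>] by simp
  qed
qed

lemma in_span_add_scaled:
  assumes "in_span n m q x" "in_span n m q y"
  shows "in_span n m q (\<lambda>i. x i + t * y i)"
proof -
  obtain c d where "\<And>i. i < n \<Longrightarrow> x i = (\<Sum>j<m. c j * q j i)" "\<And>i. i < n \<Longrightarrow> y i = (\<Sum>j<m. d j * q j i)"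
    using assms unfolding in_span_def by blast
  thus ?thesis
    by (intro in_spanI[where c = "\<lambda>j. c j + t * d j"])
      (simp add: sum.distrib sum_distrib_left distrib_right mult.assoc)
qed

lemma in_span_cong:
  assumes "\<And>i. i < n \<Longrightarrow> x i = y i" "\<And>j i. j < m \<Longrightarrow> i < n \<Longrightarrow> q j i = r j i"
  shows "in_span n m q x \<longleftrightarrow> in_span n m r y"
  unfolding in_span_def using assms by simp

text \<open>Pairing \<open>x\<close> with its own expansion shows that its squared length is
  zero.\<close>

lemma in_span_orthogonal_zero:
  assumes x: "in_span n m q x" and orth: "\<And>j. j < m \<Longrightarrow> (\<Sum>i<n. x i * q j i) = 0" and "i < n"
  shows "x i = 0"
proof -
  obtain c where c: "\<And>i. i < n \<Longrightarrow> x i = (\<Sum>j<m. c j * q j i)"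
    using x unfolding in_span_def by blast
  have "(\<Sum>i<n. x i * x i) = (\<Sum>i<n. x i * (\<Sum>j<m. c j * q j i))"
    by (intro sum.cong) (auto simp: c[symmetric])
  also have "\<dots> = (\<Sum>j<m. c j * (\<Sum>i<n. x i * q j i))"
    unfolding sum_distrib_left by (subst sum.swap) (simp add: mult_ac)
  also have "\<dots> = 0" using orth by simp
  finally show ?thesis
    using \<open>i < n\<close> by (subst (asm) sum_nonneg_eq_0_iff) auto
qed

lemma symmetric_form_swap:
  fixes a :: "nat \<Rightarrow> nat \<Rightarrow> real"
  assumes "\<And>i j. i < n \<Longrightarrow> j < n \<Longrightarrow> a i j = a j i"
  shows "(\<Sum>i<n. (\<Sum>j<n. a i j * x j) * y i) = (\<Sum>i<n. x i * (\<Sum>j<n. a i j * y j))"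
proof -
  have "(\<Sum>i<n. (\<Sum>j<n. a i j * x j) * y i) = (\<Sum>i<n. \<Sum>j<n. a j i * x j * y i)"
    unfolding sum_distrib_right by (intro sum.cong) (auto simp: assms)
  also have "\<dots> = (\<Sum>j<n. \<Sum>i<n. a j i * x j * y i)"
    by (rule sum.swap)
  finally show ?thesis
    by (simp add: sum_distrib_left mult_ac)
qed

text \<open>Gram--Schmidt along an invariant flag: the residual \<open>A q - e q\<close> of each new vector lies in
  the span of the previous eigenvectors and, by symmetry of \<open>A\<close>, is orthogonal to it.\<close>

lemma symmetric_flag_orthogonal_eigenvectors:
  fixes a p b :: "nat \<Rightarrow> nat \<Rightarrow> real" and e :: "nat \<Rightarrow> real"
  assumes sym: "\<And>i j. i < n \<Longrightarrow> j < n \<Longrightarrow> a i j = a j i"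
    and flag: "\<And>k i. k < m \<Longrightarrow> i < n \<Longrightarrow>
      (\<Sum>j<n. a i j * p k j) = e k * p k i + (\<Sum>l<k. b l k * p l i)"
    and indep: "\<And>k. k < m \<Longrightarrow> \<not> in_span n k p (p k)"
  shows "\<exists>q. (\<forall>k<m. \<forall>i<n. (\<Sum>j<n. a i j * q k j) = e k * q k i) \<and>
     (\<forall>k<m. \<forall>l<m. k \<noteq> l \<longrightarrow> (\<Sum>i<n. q k i * q l i) = 0) \<and>
     (\<forall>k<m. (\<Sum>i<n. q k i * q k i) > 0) \<and>
     (\<forall>x. in_span n m q x \<longleftrightarrow> in_span n m p x)"
  using flag indep
proof (induction m)
  case 0
  show ?case by (simp add: in_span_def)
next
  case (Suc m)
  have flag_m: "(\<Sum>j<n. a i j * p k j) = e k * p k i + (\<Sum>l<k. b l k * p l i)"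
    if "k < m" "i < n" for k i
    using that by (intro Suc.prems(1)) simp_all
  have indep_m: "\<not> in_span n k p (p k)" if "k < m" for k
    using that by (intro Suc.prems(2)) simp
  obtain q where q: "(\<forall>k<m. \<forall>i<n. (\<Sum>j<n. a i j * q k j) = e k * q k i) \<and>
      (\<forall>k<m. \<forall>l<m. k \<noteq> l \<longrightarrow> (\<Sum>i<n. q k i * q l i) = 0) \<and>
      (\<forall>k<m. (\<Sum>i<n. q k i * q k i) > 0) \<and>
      (\<forall>x. in_span n m q x \<longleftrightarrow> in_span n m p x)"
    using Suc.IH[OF flag_m indep_m] by (rule exE)
  have eig: "(\<Sum>j<n. a i j * q k j) = e k * q k i" if "k < m" "i < n" for k i
    using conjunct1[OF q] that by simp
  have orth: "(\<Sum>i<n. q k i * q l i) = 0" if "k < m" "l < m" "k \<noteq> l" for k l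
    using conjunct1[OF conjunct2[OF q]] that by simp
  have pos: "(\<Sum>i<n. q k i * q k i) > 0" if "k < m" for k
    using conjunct1[OF conjunct2[OF conjunct2[OF q]]] that by simp
  have span: "in_span n m q x \<longleftrightarrow> in_span n m p x" for x
    using conjunct2[OF conjunct2[OF conjunct2[OF q]]] by simp
  \<comment> \<open>\<open>s\<close> is the orthogonal projection of \<open>p m\<close> onto the
    span of the earlier \<open>q j\<close>, and \<open>r\<close> is what remains.\<close>
  define d where "d j = (\<Sum>i<n. p m i * q j i) / (\<Sum>i<n. q j i * q j i)" for j
  define s where "s i = (\<Sum>j<m. d j * q j i)" for i
  define r where "r i = p m i - s i" for i
  have s_span: "in_span n m q s"
    by (rule in_spanI[where c = d]) (simp add: s_def)
  have r_orth: "(\<Sum>i<n. r i * q l i) = 0" if l: "l < m" for l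
  proof -
    have "(\<Sum>i<n. s i * q l i) = (\<Sum>i<n. \<Sum>j<m. d j * (q j i * q l i))"
      by (simp add: s_def sum_distrib_right mult.assoc)
    also have "\<dots> = (\<Sum>j<m. d j * (\<Sum>i<n. q j i * q l i))"
      by (subst sum.swap) (simp add: sum_distrib_left)
    also have "\<dots> = (\<Sum>j<m. if j = l then d l * (\<Sum>i<n. q l i * q l i) else 0)"
      using orth l by (intro sum.cong) auto
    also have "\<dots> = (\<Sum>i<n. p m i * q l i)"
      using l pos[OF l] by (simp add: d_def)
    finally show ?thesis
      by (simp add: r_def left_diff_distrib sum_subtractf)
  qed
  define y where "y i = (\<Sum>j<n. a i j * r j) - e m * r i" for i
  have y_eq: "y i = (\<Sum>l<m. b l m * p l i) - (\<Sum>l<m. (d l * (e l - e m)) * q l i)" if i: "i < n" for i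
  proof -
    have "(\<Sum>j<n. a i j * s j) = (\<Sum>l<m. d l * (\<Sum>j<n. a i j * q l j))"
      unfolding s_def sum_distrib_left by (subst sum.swap) (simp add: mult_ac)
    also have "\<dots> = (\<Sum>l<m. d l * (e l * q l i))"
      using eig i by simp
    finally have As: "(\<Sum>j<n. a i j * s j) = (\<Sum>l<m. d l * (e l * q l i))" .
    have "(\<Sum>j<n. a i j * r j) = (\<Sum>j<n. a i j * p m j) - (\<Sum>j<n. a i j * s j)"
      by (simp add: r_def right_diff_distrib sum_subtractf)
    also have "(\<Sum>j<n. a i j * p m j) = e m * p m i + (\<Sum>l<m. b l m * p l i)"
      using Suc.prems(1)[of m i] i by simp
    finally show ?thesis
      unfolding y_def As r_def
      by (simp add: s_def algebra_simps sum_subtractf sum_distrib_left)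
  qed
  have y_span: "in_span n m q y"
  proof -
    have "in_span n m q (\<lambda>i. \<Sum>l<m. b l m * p l i)"
      unfolding span by (rule in_spanI) simp
    moreover have "in_span n m q (\<lambda>i. \<Sum>l<m. (d l * (e l - e m)) * q l i)"
      by (rule in_spanI) simp
    ultimately have "in_span n m q (\<lambda>i. (\<Sum>l<m. b l m * p l i) + (-1) * (\<Sum>l<m. (d l * (e l - e m)) * q l i))"
      by (rule in_span_add_scaled)
    thus ?thesis
      by (subst in_span_cong[OF y_eq refl]) simp_all
  qed
  \<comment> \<open>Symmetry moves the matrix onto \<open>q l\<close>, which it only scales, and
    \<open>r\<close> is orthogonal to \<open>q l\<close>.\<close>
  have y_orth: "(\<Sum>i<n. y i * q l i) = 0" if l: "l < m" for l
  proof -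
    have "(\<Sum>i<n. (\<Sum>j<n. a i j * r j) * q l i) = (\<Sum>i<n. r i * (\<Sum>j<n. a i j * q l j))"
      by (rule symmetric_form_swap[OF sym])
    also have "\<dots> = e l * (\<Sum>i<n. r i * q l i)"
      using eig l by (simp add: sum_distrib_left mult_ac)
    finally have "(\<Sum>i<n. (\<Sum>j<n. a i j * r j) * q l i) = 0"
      using r_orth[OF l] by simp
    moreover have "(\<Sum>i<n. e m * r i * q l i) = 0"
      using r_orth[OF l] by (simp add: mult.assoc sum_distrib_left[symmetric])
    ultimately show ?thesis
      by (simp add: y_def left_diff_distrib sum_subtractf)
  qed
  have r_eig: "(\<Sum>j<n. a i j * r j) = e m * r i" if "i < n" for i
    using in_span_orthogonal_zero[OF y_span y_orth that] by (simp add: y_def)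
  have r_pos: "(\<Sum>i<n. r i * r i) > 0"
  proof -
    have "\<exists>i<n. r i \<noteq> 0"
    proof (rule ccontr)
      assume "\<not> ?thesis"
      hence "in_span n m q (p m)"
        using s_span by (subst in_span_cong[of n _ s m q q]) (auto simp: r_def)
      thus False using span Suc.prems(2)[of m] by simp
    qed
    then obtain i where "i < n" "r i \<noteq> 0" by blast
    thus ?thesis
      by (intro sum_pos2[of _ i]) (auto simp: zero_less_mult_iff not_less_iff_gr_or_eq)
  qed
  define q' where "q' = q(m := r)"
  have q': "q' m = r" "\<And>k. k < m \<Longrightarrow> q' k = q k" by (auto simp: q'_def)
  \<comment> \<open>Equality of spans is carried through the induction because \<open>flag\<close>
    and \<open>indep\<close> speak of \<open>p\<close>, while the projection uses
    \<open>q\<close>.\<close>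
  have "in_span n (Suc m) q' x \<longleftrightarrow> in_span n (Suc m) p x" for x
  proof -
    have "in_span n m q' (\<lambda>i. x i - t * q' m i) \<longleftrightarrow> in_span n m p (\<lambda>i. x i - t * p m i)" for t
    proof -
      have "in_span n m q' (\<lambda>i. x i - t * q' m i) \<longleftrightarrow> in_span n m q (\<lambda>i. x i - t * r i)"
        by (rule in_span_cong) (auto simp: q')
      also have "\<dots> \<longleftrightarrow> in_span n m q (\<lambda>i. x i - t * p m i)"
        using in_span_add_scaled[OF _ s_span, of "\<lambda>i. x i - t * r i" "-t"]
          in_span_add_scaled[OF _ s_span, of "\<lambda>i. x i - t * p m i" t]
        by (auto simp: r_def algebra_simps)
      finally show ?thesis by (simp add: span)
    qed
    thus ?thesis by (simp add: in_span_Suc)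
  qed
  moreover have "(\<Sum>i<n. q l i * r i) = 0" if "l < m" for l
    using r_orth[OF that] by (simp add: mult.commute)
  ultimately show ?case
    using eig orth pos r_eig r_orth r_pos
    by (intro exI[of _ q']) (auto simp: less_Suc_eq q')
qed

section \<open>Real spectrum and an ordered eigenbasis\<close>

text \<open>The Hermitian form of \<open>A\<close> at an eigenvector equals its own conjugate by
  symmetry, and equals \<open>k\<close> times a positive real.\<close>

lemma symmetric_complex_eigenvalue_real:
  fixes A :: "real mat"
  assumes A: "A \<in> carrier_mat n n"
    and sym: "\<And>i j. i < n \<Longrightarrow> j < n \<Longrightarrow> A $$ (i, j) = A $$ (j, i)"
    and ev: "eigenvalue (map_mat complex_of_real A) k"
  shows "k \<in> \<real>"
proof -
  obtain v where v: "v \<in> carrier_vec n" "v \<noteq> 0\<^sub>v n"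
    and Av: "map_mat complex_of_real A *\<^sub>v v = k \<cdot>\<^sub>v v"
    using ev A unfolding eigenvalue_def eigenvector_def by auto
  have Av_i: "(\<Sum>j<n. of_real (A $$ (i, j)) * v $ j) = k * v $ i" if "i < n" for i
    using arg_cong[OF Av, of "\<lambda>w. w $ i"] that v A
    by (simp add: scalar_prod_def atLeast0LessThan)
  define s where "s = (\<Sum>i<n. \<Sum>j<n. cnj (v $ i) * (of_real (A $$ (i, j)) * v $ j))"
  define N where "N = (\<Sum>i<n. (norm (v $ i))\<^sup>2)"
  have "s = (\<Sum>i<n. cnj (v $ i) * (k * v $ i))"
    unfolding s_def sum_distrib_left[symmetric] by (intro sum.cong) (auto simp: Av_i)
  also have "\<dots> = k * of_real N"
    unfolding N_def of_real_sum sum_distrib_left complex_norm_square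
    by (simp add: mult_ac)
  finally have s: "s = k * of_real N" .
  have "cnj s = (\<Sum>i<n. \<Sum>j<n. cnj (v $ j) * (of_real (A $$ (j, i)) * v $ i))"
    unfolding s_def cnj_sum by (intro sum.cong) (auto simp: sym)
  also have "\<dots> = s"
    unfolding s_def by (rule sum.swap)
  finally have "cnj k * of_real N = k * of_real N"
    unfolding s by simp
  moreover have "N > 0"
  proof -
    obtain i where "i < n" "v $ i \<noteq> 0"
      using v by (metis carrier_vecD eq_vecI index_zero_vec(1,2))
    thus ?thesis unfolding N_def
      by (intro sum_pos2[of _ i]) auto
  qed
  ultimately show ?thesis
    by (simp add: Reals_cnj_iff)
qed

lemma map_poly_of_real_mult:
  "map_poly complex_of_real (p * q) = map_poly complex_of_real p * map_poly complex_of_real q"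
proof -
  interpret map_poly_inj_comm_ring_hom complex_of_real ..
  show ?thesis by (rule hom_mult)
qed

text \<open>The polynomial factors over the complex numbers, its roots are eigenvalues and hence
  real, and the factorisation descends because the embedding of the reals is injective on
  coefficients.\<close>

lemma symmetric_char_poly_splits:
  fixes A :: "real mat"
  assumes A: "A \<in> carrier_mat n n"
    and sym: "\<And>i j. i < n \<Longrightarrow> j < n \<Longrightarrow> A $$ (i, j) = A $$ (j, i)"
  obtains es where "char_poly A = (\<Prod>e\<leftarrow>es. [:- e, 1:])" "length es = n"
proof -
  let ?C = "map_mat complex_of_real A"
  have C: "?C \<in> carrier_mat n n" using A by simp
  obtain as where as: "char_poly ?C = (\<Prod>a\<leftarrow>as. [:- a, 1:])" "length as = n"
    using char_poly_factorized[OF C] by blast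
  define es where "es = map Re as"
  have "a \<in> \<real>" if "a \<in> set as" for a
  proof (rule symmetric_complex_eigenvalue_real[OF A sym])
    show "eigenvalue ?C a"
      unfolding eigenvalue_root_char_poly[OF C] as(1) using that
      by (auto simp: poly_prod_list prod_list_zero_iff)
  qed
  hence as_es: "as = map complex_of_real es"
    unfolding es_def by (auto simp: map_idI)
  have "map_poly complex_of_real (char_poly A) = char_poly ?C"
    by (rule of_real_hom.char_poly_hom[OF A, symmetric])
  also have "\<dots> = map_poly complex_of_real (\<Prod>e\<leftarrow>es. [:- e, 1:])"
    unfolding as(1) as_es by (induction es) (simp_all add: map_poly_of_real_mult map_poly_pCons del: mult_pCons_left)
  finally have "char_poly A = (\<Prod>e\<leftarrow>es. [:- e, 1:])"
    by (simp add: poly_eq_iff coeff_map_poly)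
  with as(2) show thesis
    by (intro that[of es]) (simp_all add: es_def)
qed

lemma proots_prod_linear: "proots (\<Prod>e\<leftarrow>es. [:- e, 1 :: real:]) = mset es"
proof (induction es)
  case (Cons e es)
  have "(\<Prod>e\<leftarrow>es. [:- e, 1 :: real:]) \<noteq> 0"
    by (auto simp: prod_list_zero_iff)
  with Cons show ?case
    by (simp add: proots_mult del: mult_pCons_left)
qed simp

text \<open>\<open>proots\<close> collects real roots only; the splitting shows that none is lost,
  so the list has \<open>n\<close> entries and indexing it is meaningful.\<close>

lemma symmetric_char_poly_eigenvalues_desc:
  fixes A :: "real mat"
  assumes A: "A \<in> carrier_mat n n"
    and sym: "\<And>i j. i < n \<Longrightarrow> j < n \<Longrightarrow> A $$ (i, j) = A $$ (j, i)"
  shows "char_poly A = (\<Prod>e\<leftarrow>eigenvalues_desc A. [:- e, 1:])" "length (eigenvalues_desc A) = n"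
proof -
  obtain es where es: "char_poly A = (\<Prod>e\<leftarrow>es. [:- e, 1:])" "length es = n"
    using symmetric_char_poly_splits[OF A sym] by blast
  have mset: "mset (eigenvalues_desc A) = mset es"
    by (simp add: eigenvalues_desc_def es(1) proots_prod_linear)
  show "length (eigenvalues_desc A) = n"
    using mset_eq_length[OF mset] es(2) by simp
  have "mset (map (\<lambda>e. [:- e, 1:]) (eigenvalues_desc A)) = mset (map (\<lambda>e. [:- e, 1:]) es)"
    using mset by simp
  thus "char_poly A = (\<Prod>e\<leftarrow>eigenvalues_desc A. [:- e, 1:])"
    unfolding es(1) by (metis prod_mset_prod_list)
qed

lemma eigenvalues_desc_antimono:
  assumes "k \<le> l" "l < length (eigenvalues_desc A)"
  shows "eigenvalues_desc A ! l \<le> eigenvalues_desc A ! k"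
proof -
  have "sorted (rev (eigenvalues_desc A))" by (simp add: eigenvalues_desc_def)
  thus ?thesis using assms sorted_rev_nth_mono by blast
qed

text \<open>Schur decomposition puts the eigenvalues on the diagonal in the prescribed order. The
  columns of \<open>P\<close> then form an invariant flag, and Gram--Schmidt along it keeps both
  order and multiplicity.\<close>

lemma symmetric_orthogonal_eigenvectors:
  fixes A :: "real mat"
  assumes A: "A \<in> carrier_mat n n"
    and sym: "\<And>i j. i < n \<Longrightarrow> j < n \<Longrightarrow> A $$ (i, j) = A $$ (j, i)"
  obtains q :: "nat \<Rightarrow> nat \<Rightarrow> real" where
    "\<And>k i. k < n \<Longrightarrow> i < n \<Longrightarrow> (\<Sum>j<n. A $$ (i, j) * q k j) = eigenvalues_desc A ! k * q k i"
    "\<And>k l. k < n \<Longrightarrow> l < n \<Longrightarrow> k \<noteq> l \<Longrightarrow> (\<Sum>i<n. q k i * q l i) = 0"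
    "\<And>k. k < n \<Longrightarrow> (\<Sum>i<n. q k i * q k i) > 0"
proof -
  let ?es = "eigenvalues_desc A"
  obtain B P Q where "schur_decomposition A ?es = (B, P, Q)"
    by (cases "schur_decomposition A ?es") auto
  from schur_decomposition[OF A symmetric_char_poly_eigenvalues_desc(1)[OF A sym] this]
  have wit: "similar_mat_wit A B P Q" and upper: "upper_triangular B" and diag: "diag_mat B = ?es"
    by auto
  note w = similar_mat_witD2[OF A wit]
  have diagB: "B $$ (k, k) = ?es ! k" if "k < n" for k
    using that w(5) by (simp add: diag[symmetric] diag_mat_def)
  have AP: "A * P = P * B"
  proof -
    have "A * P = P * B * (Q * P)"
      unfolding w(3) using w(5-7) by (simp add: assoc_mult_mat[of _ n n _ n _ n])
    thus ?thesis using w(2,5,6) by simp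
  qed
  define p where "p k i = P $$ (i, k)" for k i
  have flag: "(\<Sum>j<n. A $$ (i, j) * p k j) = ?es ! k * p k i + (\<Sum>l<k. B $$ (l, k) * p l i)"
    if k: "k < n" and i: "i < n" for k i
  proof -
    have "(\<Sum>j<n. A $$ (i, j) * p k j) = (A * P) $$ (i, k)"
      using k i A w(6) by (simp add: p_def scalar_prod_def atLeast0LessThan)
    also have "\<dots> = (\<Sum>l<n. B $$ (l, k) * p l i)"
      unfolding AP using k i w(5,6) by (simp add: p_def scalar_prod_def atLeast0LessThan mult.commute)
    also have "\<dots> = (\<Sum>l<Suc k. B $$ (l, k) * p l i)"
      using k upper w(5) by (intro sum.mono_neutral_right) (auto simp: upper_triangular_def)
    finally show ?thesis using diagB[OF k] by simp
  qed
  \<comment> \<open>Row \<open>k\<close> of the inverse \<open>Q\<close> annihilates every earlier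
    column of \<open>P\<close> but gives 1 on column \<open>k\<close>.\<close>
  have indep: "\<not> in_span n k p (p k)" if k: "k < n" for k
  proof
    assume "in_span n k p (p k)"
    then obtain c where c: "\<And>i. i < n \<Longrightarrow> p k i = (\<Sum>l<k. c l * p l i)"
      unfolding in_span_def by blast
    have QP: "(\<Sum>i<n. Q $$ (k, i) * p l i) = (if l = k then 1 else 0)" if l: "l < n" for l
    proof -
      have "(\<Sum>i<n. Q $$ (k, i) * p l i) = (Q * P) $$ (k, l)"
        using k l w(6,7) by (simp add: p_def scalar_prod_def atLeast0LessThan)
      thus ?thesis unfolding w(2) using k l by simp
    qed
    have "(\<Sum>i<n. Q $$ (k, i) * p k i) = (\<Sum>i<n. Q $$ (k, i) * (\<Sum>l<k. c l * p l i))"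
      by (intro sum.cong) (auto simp: c[symmetric])
    also have "\<dots> = (\<Sum>l<k. c l * (\<Sum>i<n. Q $$ (k, i) * p l i))"
      unfolding sum_distrib_left by (subst sum.swap) (simp add: mult_ac)
    also have "\<dots> = 0" using QP k by simp
    finally show False using QP[OF k] by simp
  qed
  obtain q where q: "(\<forall>k<n. \<forall>i<n. (\<Sum>j<n. A $$ (i, j) * q k j) = ?es ! k * q k i) \<and>
      (\<forall>k<n. \<forall>l<n. k \<noteq> l \<longrightarrow> (\<Sum>i<n. q k i * q l i) = 0) \<and>
      (\<forall>k<n. (\<Sum>i<n. q k i * q k i) > 0) \<and>
      (\<forall>x. in_span n n q x \<longleftrightarrow> in_span n n p x)"
    using symmetric_flag_orthogonal_eigenvectors[where n = n and m = n and p = p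
        and a = "\<lambda>i j. A $$ (i, j)" and e = "\<lambda>k. ?es ! k" and b = "\<lambda>l k. B $$ (l, k)",
        OF sym flag indep]
    by (rule exE)
  show thesis
  proof (rule that[of q])
    show "(\<Sum>j<n. A $$ (i, j) * q k j) = ?es ! k * q k i" if "k < n" "i < n" for k i
      using conjunct1[OF q] that by simp
    show "(\<Sum>i<n. q k i * q l i) = 0" if "k < n" "l < n" "k \<noteq> l" for k l
      using conjunct1[OF conjunct2[OF q]] that by simp
    show "(\<Sum>i<n. q k i * q k i) > 0" if "k < n" for k
      using conjunct1[OF conjunct2[OF conjunct2[OF q]]] that by simp
  qed
qed

section \<open>The third eigenvalue\<close>

lemma sum_mult_orthogonal_expansions:
  fixes q :: "nat \<Rightarrow> nat \<Rightarrow> real"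
  assumes orth: "\<And>k l. k < m \<Longrightarrow> l < m \<Longrightarrow> k \<noteq> l \<Longrightarrow> (\<Sum>i<n. q k i * q l i) = 0"
  shows "(\<Sum>i<n. (\<Sum>k<m. c k * q k i) * (\<Sum>l<m. d l * q l i)) = (\<Sum>k<m. c k * d k * (\<Sum>i<n. q k i * q k i))"
proof -
  have "(\<Sum>i<n. (\<Sum>k<m. c k * q k i) * (\<Sum>l<m. d l * q l i)) = (\<Sum>i<n. \<Sum>k<m. \<Sum>l<m. c k * d l * (q k i * q l i))"
    by (simp only: sum_product mult_ac)
  also have "\<dots> = (\<Sum>k<m. \<Sum>i<n. \<Sum>l<m. c k * d l * (q k i * q l i))"
    by (rule sum.swap)
  also have "\<dots> = (\<Sum>k<m. \<Sum>l<m. \<Sum>i<n. c k * d l * (q k i * q l i))"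
    by (intro sum.cong refl sum.swap)
  also have "\<dots> = (\<Sum>k<m. \<Sum>l<m. if l = k then c k * d k * (\<Sum>i<n. q k i * q k i) else 0)"
    using orth by (intro sum.cong refl) (auto simp: sum_distrib_left[symmetric])
  finally show ?thesis by simp
qed

text \<open>In the eigenvector coordinates the form is diagonal with coefficients
  \<open>e k\<close>. The \<open>q k\<close> are not normalised, so their squared lengths stay as
  nonnegative weights.\<close>

lemma eigenspan_form_ge:
  fixes a q :: "nat \<Rightarrow> nat \<Rightarrow> real"
  assumes eig: "\<And>k i. k < m \<Longrightarrow> i < n \<Longrightarrow> (\<Sum>j<n. a i j * q k j) = e k * q k i"
    and orth: "\<And>k l. k < m \<Longrightarrow> l < m \<Longrightarrow> k \<noteq> l \<Longrightarrow> (\<Sum>i<n. q k i * q l i) = 0"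
    and ge: "\<And>k. k < m \<Longrightarrow> lam \<le> e k"
    and x: "\<And>i. i < n \<Longrightarrow> x i = (\<Sum>k<m. c k * q k i)"
  shows "lam * (\<Sum>i<n. (x i)\<^sup>2) \<le> (\<Sum>i<n. \<Sum>j<n. a i j * (x i * x j))"
proof -
  have Ax: "(\<Sum>j<n. a i j * x j) = (\<Sum>k<m. c k * e k * q k i)" if i: "i < n" for i
  proof -
    have "(\<Sum>j<n. a i j * x j) = (\<Sum>j<n. \<Sum>k<m. c k * (a i j * q k j))"
      by (intro sum.cong) (auto simp: x sum_distrib_left mult_ac)
    also have "\<dots> = (\<Sum>k<m. c k * (\<Sum>j<n. a i j * q k j))"
      by (subst sum.swap) (simp add: sum_distrib_left)
    finally show ?thesis using eig i by (simp add: mult.assoc)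
  qed
  have expand: "(\<Sum>i<n. (\<Sum>k<m. c k * q k i) * (\<Sum>k<m. d k * q k i)) =
      (\<Sum>k<m. c k * d k * (\<Sum>i<n. q k i * q k i))" for d
    by (rule sum_mult_orthogonal_expansions[OF orth])
  have "lam * (\<Sum>i<n. (x i)\<^sup>2) = lam * (\<Sum>i<n. (\<Sum>k<m. c k * q k i) * (\<Sum>k<m. c k * q k i))"
    by (simp add: x power2_eq_square)
  also have "\<dots> = (\<Sum>k<m. lam * (c k * c k * (\<Sum>i<n. q k i * q k i)))"
    by (simp only: expand sum_distrib_left[of lam])
  also have "\<dots> \<le> (\<Sum>k<m. e k * (c k * c k * (\<Sum>i<n. q k i * q k i)))"
    using ge by (intro sum_mono mult_right_mono) (auto intro: mult_nonneg_nonneg[OF zero_le_square sum_nonneg[OF zero_le_square]])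
  also have "\<dots> = (\<Sum>k<m. c k * (c k * e k) * (\<Sum>i<n. q k i * q k i))"
    by (simp add: mult_ac)
  also have "\<dots> = (\<Sum>i<n. (\<Sum>k<m. c k * q k i) * (\<Sum>k<m. c k * e k * q k i))"
    by (rule expand[symmetric])
  also have "\<dots> = (\<Sum>i<n. x i * (\<Sum>j<n. a i j * x j))"
    by (intro sum.cong) (auto simp: x[symmetric] Ax)
  also have "\<dots> = (\<Sum>i<n. \<Sum>j<n. a i j * (x i * x j))"
    by (simp add: sum_distrib_left mult_ac)
  finally show ?thesis .
qed

text \<open>A linear functional on three-space has a kernel of dimension at least two; the cases
  pivot on its first nonzero coefficient.\<close>

lemma exists_plane_in_kernel:
  fixes c :: "nat \<Rightarrow> real"
  obtains u v :: "nat \<Rightarrow> real" where "(\<Sum>k<3. u k * c k) = 0" "(\<Sum>k<3. v k * c k) = 0"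
    "\<And>s t. \<forall>k<3. s * u k + t * v k = 0 \<Longrightarrow> s = 0 \<and> t = 0"
proof -
  have sum3: "(\<Sum>k<3. f k) = f 0 + f 1 + f 2" for f :: "nat \<Rightarrow> real"
    by (simp add: numeral_3_eq_3 numeral_2_eq_2)
  consider "c 0 \<noteq> 0" | "c 0 = 0" "c 1 \<noteq> 0" | "c 0 = 0" "c 1 = 0" by blast
  thus thesis
  proof cases
    case 1
    define u where "u = (\<lambda>k::nat. if k = 0 then c 1 else if k = 1 then - c 0 else 0)"
    define v where "v = (\<lambda>k::nat. if k = 0 then c 2 else if k = 2 then - c 0 else 0)"
    show thesis
    proof (rule that[of u v])
      fix s t assume st: "\<forall>k<3. s * u k + t * v k = 0"
      show "s = 0 \<and> t = 0" using st[rule_format, of 1] st[rule_format, of 2] 1 by (simp add: u_def v_def)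
    qed (simp_all add: sum3 u_def v_def)
  next
    case 2
    define u where "u = (\<lambda>k::nat. if k = 0 then 1 else 0 :: real)"
    define v where "v = (\<lambda>k::nat. if k = 1 then c 2 else if k = 2 then - c 1 else 0)"
    show thesis
    proof (rule that[of u v])
      fix s t assume st: "\<forall>k<3. s * u k + t * v k = 0"
      show "s = 0 \<and> t = 0" using st[rule_format, of 0] st[rule_format, of 2] 2 by (simp add: u_def v_def)
    qed (simp_all add: sum3 u_def v_def 2)
  next
    case 3
    define u where "u = (\<lambda>k::nat. if k = 0 then 1 else 0 :: real)"
    define v where "v = (\<lambda>k::nat. if k = 1 then 1 else 0 :: real)"
    show thesis
    proof (rule that[of u v])
      fix s t assume st: "\<forall>k<3. s * u k + t * v k = 0"
      show "s = 0 \<and> t = 0" using st[rule_format, of 0] st[rule_format, of 1] by (simp add: u_def v_def)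
    qed (use 3 in \<open>simp_all add: sum3 u_def v_def\<close>)
  qed
qed

theorem theorem1p3:
  fixes n :: nat and E :: "nat \<Rightarrow> nat \<Rightarrow> bool"
  assumes "simple_graph n E" and "n \<ge> 3"
  shows "lambda_k 3 (adj_matrix n E) \<le> real n / 3 - 1"
proof -
  define A where "A = adj_matrix n E"
  define a where "a i j = A $$ (i, j)" for i j
  define B where "B i j = a i j + (if i = j then 1 else 0)" for i j
  define e where "e k = eigenvalues_desc A ! k" for k
  have A: "A \<in> carrier_mat n n" by (simp add: A_def adj_matrix_def)
  have sym: "A $$ (i, j) = A $$ (j, i)" if "i < n" "j < n" for i j
    using assms(1) that by (simp add: A_def adj_matrix_def simple_graph_def)
  have B01: "0 \<le> B i j \<and> B i j \<le> 1" if "i \<in> {..<n}" "j \<in> {..<n}" for i j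
    using assms(1) that by (auto simp: B_def a_def A_def adj_matrix_def simple_graph_def)
  obtain q where eig: "\<And>k i. k < n \<Longrightarrow> i < n \<Longrightarrow> (\<Sum>j<n. a i j * q k j) = e k * q k i"
    and orth: "\<And>k l. k < n \<Longrightarrow> l < n \<Longrightarrow> k \<noteq> l \<Longrightarrow> (\<Sum>i<n. q k i * q l i) = 0"
    and pos: "\<And>k. k < n \<Longrightarrow> (\<Sum>i<n. q k i * q k i) > 0"
    using symmetric_orthogonal_eigenvectors[OF A sym] unfolding a_def e_def by blast
  have orth3: "(\<Sum>i<n. q k i * q l i) = 0" if "k < 3" "l < 3" "k \<noteq> l" for k l
    using orth that \<open>n \<ge> 3\<close> by simp
  have eig3: "(\<Sum>j<n. a i j * q k j) = e k * q k i" if "k < 3" "i < n" for k i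
    using eig that \<open>n \<ge> 3\<close> by simp
  \<comment> \<open>Lists are indexed from 0, so \<open>e 2\<close> is the third largest
    eigenvalue.\<close>
  have e2: "e 2 \<le> e k" if "k < 3" for k
    unfolding e_def using that \<open>n \<ge> 3\<close>
    by (intro eigenvalues_desc_antimono) (auto simp: symmetric_char_poly_eigenvalues_desc(2)[OF A sym])
  \<comment> \<open>The functional sends a coefficient vector to the entry sum of the combination,
    so its kernel yields vectors orthogonal to the all-ones vector.\<close>
  obtain u v where u: "(\<Sum>k<3. u k * (\<Sum>i<n. q k i)) = 0" and v: "(\<Sum>k<3. v k * (\<Sum>i<n. q k i)) = 0"
    and uv: "\<And>s t. \<forall>k<3. s * u k + t * v k = 0 \<Longrightarrow> s = 0 \<and> t = 0"
    using exists_plane_in_kernel[of "\<lambda>k. \<Sum>i<n. q k i"] by blast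
  define x where "x i = (\<Sum>k<3. u k * q k i)" for i
  define y where "y i = (\<Sum>k<3. v k * q k i)" for i
  have x0: "(\<Sum>i<n. x i) = 0"
    unfolding x_def using u by (subst sum.swap) (simp add: sum_distrib_left)
  have y0: "(\<Sum>i<n. y i) = 0"
    unfolding y_def using v by (subst sum.swap) (simp add: sum_distrib_left)
  have comb: "s * x i + t * y i = (\<Sum>k<3. (s * u k + t * v k) * q k i)" for s t i
    by (simp add: x_def y_def sum_distrib_left sum.distrib distrib_right mult.assoc)
  have indep: "s = 0 \<and> t = 0" if st: "\<And>i. i \<in> {..<n} \<Longrightarrow> s * x i + t * y i = 0" for s t
  proof (rule uv, intro allI impI)
    fix k :: nat assume k: "k < 3"
    define c where "c l = s * u l + t * v l" for l
    \<comment> \<open>By orthogonality the squared length of the vanishing combination is a sum of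
      nonnegative terms, so each coefficient is zero.\<close>
    have "0 = (\<Sum>i<n. (\<Sum>l<3. c l * q l i) * (\<Sum>l<3. c l * q l i))"
      using st unfolding comb c_def by simp
    also have "\<dots> = (\<Sum>l<3. c l * c l * (\<Sum>i<n. q l i * q l i))"
      by (rule sum_mult_orthogonal_expansions[OF orth3])
    finally have "(\<Sum>l<3. c l * c l * (\<Sum>i<n. q l i * q l i)) = 0" by simp
    hence "c k * c k * (\<Sum>i<n. q k i * q k i) = 0"
      using k by (subst (asm) sum_nonneg_eq_0_iff)
        (auto intro: mult_nonneg_nonneg[OF zero_le_square sum_nonneg[OF zero_le_square]])
    moreover have "(\<Sum>i<n. q k i * q k i) > 0" using pos[of k] k \<open>n \<ge> 3\<close> by simp
    ultimately show "s * u k + t * v k = 0" by (auto simp: c_def)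
  qed
  obtain s t where st: "s \<noteq> 0 \<or> t \<noteq> 0"
    and le: "(\<Sum>i<n. \<Sum>j<n. B i j * ((s * x i + t * y i) * (s * x j + t * y j)))
       \<le> card {..<n} / 3 * (\<Sum>i<n. (s * x i + t * y i)\<^sup>2)"
    using exists_small_form_in_plane[of "{..<n}" B x y, OF finite_lessThan B01 x0 y0 indep] by blast
  define w where "w i = s * x i + t * y i" for i
  have "\<exists>i<n. w i \<noteq> 0"
    using indep[of s t] st unfolding w_def by auto
  then obtain i where "i < n" "w i \<noteq> 0" by blast
  hence w_pos: "(\<Sum>i<n. (w i)\<^sup>2) > 0"
    by (intro sum_pos2[of _ i]) auto
  have "(e 2 + 1) * (\<Sum>i<n. (w i)\<^sup>2) \<le> (\<Sum>i<n. \<Sum>j<n. a i j * (w i * w j)) + (\<Sum>i<n. (w i)\<^sup>2)"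
  proof -
    have "e 2 * (\<Sum>i<n. (w i)\<^sup>2) \<le> (\<Sum>i<n. \<Sum>j<n. a i j * (w i * w j))"
      by (rule eigenspan_form_ge[OF eig3 orth3 e2]) (simp_all add: w_def comb)
    thus ?thesis by (simp add: distrib_right)
  qed
  also have "\<dots> = (\<Sum>i<n. \<Sum>j<n. B i j * (w i * w j))"
  proof -
    have "(\<Sum>j<n. B i j * (w i * w j)) = (\<Sum>j<n. a i j * (w i * w j)) + (w i)\<^sup>2" if "i < n" for i
    proof -
      have "(\<Sum>j<n. B i j * (w i * w j)) =
          (\<Sum>j<n. a i j * (w i * w j)) + (\<Sum>j<n. if i = j then w i * w i else 0)"
        unfolding sum.distrib[symmetric] by (intro sum.cong) (auto simp: B_def distrib_right)
      thus ?thesis using that by (simp add: power2_eq_square)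
    qed
    thus ?thesis by (simp add: sum.distrib)
  qed
  also have "\<dots> \<le> real n / 3 * (\<Sum>i<n. (w i)\<^sup>2)"
    using le by (simp add: w_def)
  finally have "e 2 + 1 \<le> real n / 3"
    using w_pos by (simp only: mult_le_cancel_right_pos)
  thus ?thesis
    by (simp add: lambda_k_def e_def A_def)
qed

end
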